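(* There exists a circle graph that is not $132$-representable.
   Context: All graphs are simple. A circle graph is a graph whose vertices can be associated with chords of a circle so that two chords intersect if and only if the corresponding vertices are adjacent. A word is a finite sequence $w=w_1w_2\cdots w_n$ of letters from a totally ordered alphabet. Two letters $x,y$ alternate in $w$ if (after deleting all other letters) between any two occurrences of $x$ there is an occurrence of $y$ and between any two occurrences of $y$ there is an occurrence of $x$. A graph $G=(V,E)$ is represented by a word $w$ over $V$ if for all distinct $x,y\in V$, $x$ and $y$ alternate in $w$ if and only if $xy\in E$. A word $w$ contains a pattern $\tau=\tau_1\cdots\tau_k$ (a permutation) if some subsequence $w_{i_1}\cdots w_{i_k}$ ($i_1<\dots<i_k$) is order-isomorphic to $\tau$; otherwise $w$ avoids $\tau$. A graph is $\tau$-representable if, after labeling its vertices by distinct elements of a totally ordered set (any labeling may be chosen), it is represented by a word that avoids $\tau$. *)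

theory Defs
  imports "HOL-Analysis.Analysis" "HOL-Library.Sublist"
begin

definition simple_graph :: "'a set \<Rightarrow> 'a set set \<Rightarrow> bool" where
  "simple_graph V E \<longleftrightarrow> finite V \<and> (\<forall>e\<in>E. e \<subseteq> V \<and> card e = 2)"

definition is_chord :: "complex \<Rightarrow> real \<Rightarrow> complex set \<Rightarrow> bool" where
  "is_chord c r S \<longleftrightarrow> (\<exists>a b. a \<in> sphere c r \<and> b \<in> sphere c r \<and> a \<noteq> b \<and> S = closed_segment a b)"

definition circle_graph :: "'a set \<Rightarrow> 'a set set \<Rightarrow> bool" where
  "circle_graph V E \<longleftrightarrow> simple_graph V E \<and>
     (\<exists>c r f. 0 < r \<and> (\<forall>v\<in>V. is_chord c r (f v)) \<and>
        (\<forall>x\<in>V. \<forall>y\<in>V. x \<noteq> y \<longrightarrow> (f x \<inter> f y \<noteq> {} \<longleftrightarrow> {x, y} \<in> E)))"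

definition separates :: "'a \<Rightarrow> 'a \<Rightarrow> 'a list \<Rightarrow> bool" where
  "separates y x u \<longleftrightarrow> (\<forall>i j. i < j \<and> j < length u \<and> u ! i = x \<and> u ! j = x \<longrightarrow>
     (\<exists>k. i < k \<and> k < j \<and> u ! k = y))"

definition alternate :: "'a \<Rightarrow> 'a \<Rightarrow> 'a list \<Rightarrow> bool" where
  "alternate x y w \<longleftrightarrow>
     separates y x (filter (\<lambda>z. z \<in> {x, y}) w) \<and> separates x y (filter (\<lambda>z. z \<in> {x, y}) w)"

text \<open>A word over \<open>V\<close> is not required to use every letter of \<open>V\<close>. For
  \<open>pattern_representable [1, 3, 2]\<close> below this makes no difference: an absent letter
  alternates with exactly the letters occurring at most once, as it does when it is written once
  at the very beginning of the word. Writing the absent letters there in decreasing order,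
  relabelled so as to exceed all other labels, creates no occurrence of 132.\<close>

definition represents :: "'a set \<Rightarrow> 'a set set \<Rightarrow> 'a list \<Rightarrow> bool" where
  "represents V E w \<longleftrightarrow> set w \<subseteq> V \<and>
     (\<forall>x\<in>V. \<forall>y\<in>V. x \<noteq> y \<longrightarrow> (alternate x y w \<longleftrightarrow> {x, y} \<in> E))"

text \<open>Since the entries of a permutation are distinct, comparing by \<open><\<close> in both directions also
  rules out equal entries in \<open>u\<close>.\<close>

definition order_isomorphic :: "'b::linorder list \<Rightarrow> nat list \<Rightarrow> bool" where
  "order_isomorphic u p \<longleftrightarrow> length u = length p \<and>
     (\<forall>i < length p. \<forall>j < length p. u ! i < u ! j \<longleftrightarrow> p ! i < p ! j)"

definition avoids :: "'b::linorder list \<Rightarrow> nat list \<Rightarrow> bool" where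
  "avoids w p \<longleftrightarrow> \<not> (\<exists>u. subseq u w \<and> order_isomorphic u p)"

definition represented_under :: "nat list \<Rightarrow> ('a \<Rightarrow> 'b::linorder) \<Rightarrow> 'a set \<Rightarrow> 'a set set \<Rightarrow> bool" where
  "represented_under p l V E \<longleftrightarrow> inj_on l V \<and>
     (\<exists>w. represents (l ` V) ((`) l ` E) w \<and> avoids w p)"

text \<open>For finite graphs it suffices to take labels in \<^typ>\<open>nat\<close>; see
  \<open>pattern_representableI\<close>.\<close>

definition pattern_representable :: "nat list \<Rightarrow> 'a set \<Rightarrow> 'a set set \<Rightarrow> bool" where
  "pattern_representable p V E \<longleftrightarrow> (\<exists>l :: 'a \<Rightarrow> nat. represented_under p l V E)"

lemma separates_map:
  assumes "inj_on g A" "set u \<subseteq> A" "x \<in> A" "y \<in> A"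
  shows "separates (g y) (g x) (map g u) \<longleftrightarrow> separates y x u"
proof -
  have *: "map g u ! i = g z \<longleftrightarrow> u ! i = z" if "i < length u" "z \<in> A" for i z
    using assms that by (metis inj_onD nth_map nth_mem subsetD)
  have *: "(i < j \<and> j < length u \<and> map g u ! i = g x \<and> map g u ! j = g x \<longrightarrow>
        (\<exists>k. i < k \<and> k < j \<and> map g u ! k = g y)) \<longleftrightarrow>
      (i < j \<and> j < length u \<and> u ! i = x \<and> u ! j = x \<longrightarrow>
        (\<exists>k. i < k \<and> k < j \<and> u ! k = y))" for i j
  proof (cases "i < j \<and> j < length u")
    case True
    then have "map g u ! k = g y \<longleftrightarrow> u ! k = y" if "k < j" for k
      using *[OF _ assms(4)] that by simp
    then have "(\<exists>k. i < k \<and> k < j \<and> map g u ! k = g y) \<longleftrightarrow> (\<exists>k. i < k \<and> k < j \<and> u ! k = y)"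
      by blast
    then show ?thesis
      using True *[OF _ assms(3), of i] *[OF _ assms(3), of j] by simp
  qed auto
  show ?thesis
    unfolding separates_def length_map * ..
qed

lemma alternate_map:
  assumes "inj_on g A" "set w \<subseteq> A" "x \<in> A" "y \<in> A"
  shows "alternate (g x) (g y) (map g w) \<longleftrightarrow> alternate x y w"
proof -
  have "filter (\<lambda>z. z \<in> {g x, g y}) (map g w) = map g (filter (\<lambda>z. z \<in> {x, y}) w)"
    unfolding filter_map
    by (rule arg_cong[of _ _ "map g"], rule filter_cong)
      (use assms in \<open>auto dest: inj_onD\<close>)
  moreover have "set (filter (\<lambda>z. z \<in> {x, y}) w) \<subseteq> A" using assms by auto
  ultimately show ?thesis
    unfolding alternate_def using separates_map[OF assms(1) _ assms(3,4)] separates_map[OF assms(1) _ assms(4,3)] by simp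
qed

lemma pattern_representableI:
  fixes l :: "'a \<Rightarrow> 'b::linorder"
  assumes "simple_graph V E" "represented_under p l V E"
  shows "pattern_representable p V E"
proof -
  let ?A = "l ` V"
  define g where "g b = card {c \<in> ?A. c < b}" for b
  have fin: "finite ?A" using assms(1) by (simp add: simple_graph_def)
  have less: "g a < g b" if "a \<in> ?A" "a < b" for a b
    unfolding g_def by (rule psubset_card_mono) (use fin that in auto)
  have iff: "g a < g b \<longleftrightarrow> a < b" if "a \<in> ?A" "b \<in> ?A" for a b
    using less that by (metis linorder_neqE order_less_asym less_irrefl)
  have inj: "inj_on g ?A"
    by (rule inj_onI) (metis iff linorder_neqE less_irrefl)
  obtain w where l: "inj_on l V" and r: "represents ?A ((`) l ` E) w" and av: "avoids w p"
    using assms(2) by (auto simp: represented_under_def)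
  have w: "set w \<subseteq> ?A" using r by (simp add: represents_def)
  have EA: "e \<subseteq> ?A" if "e \<in> (`) l ` E" for e
    using that assms(1) by (auto simp: simple_graph_def)
  have edge: "{g x, g y} \<in> (`) g ` ((`) l ` E) \<longleftrightarrow> {x, y} \<in> (`) l ` E" (is "?L \<longleftrightarrow> ?R")
    if "x \<in> ?A" "y \<in> ?A" for x y
  proof
    assume ?L
    then obtain e where e: "e \<in> (`) l ` E" "g ` {x, y} = g ` e" by auto
    then have "{x, y} = e"
      using inj_on_image_eq_iff[OF inj, of "{x, y}" e] EA[OF e(1)] that by auto
    then show ?R using e by simp
  next
    assume ?R
    then show ?L using image_eqI[of "{g x, g y}" "(`) g" "{x, y}"] by auto
  qed
  have im: "(g \<circ> l) ` V = g ` ?A" "(`) (g \<circ> l) ` E = (`) g ` ((`) l ` E)"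
    by (auto simp: image_comp image_image)
  have "represents (g ` ?A) ((`) g ` ((`) l ` E)) (map g w)"
    unfolding represents_def
  proof (intro conjI ballI impI)
    show "set (map g w) \<subseteq> g ` ?A" using w by auto
  next
    fix x' y' assume as: "x' \<in> g ` ?A" "y' \<in> g ` ?A" "x' \<noteq> y'"
    from as(1) obtain x where x: "x' = g x" "x \<in> ?A" by (rule imageE)
    from as(2) obtain y where y: "y' = g y" "y \<in> ?A" by (rule imageE)
    note xy = x(2) y(2) x(1) y(1)
    have "x \<noteq> y" using as(3) xy by auto
    then have "alternate x y w \<longleftrightarrow> {x, y} \<in> (`) l ` E"
      using r[unfolded represents_def, THEN conjunct2, rule_format, OF xy(1,2)] by simp
    then show "alternate x' y' (map g w) \<longleftrightarrow> {x', y'} \<in> (`) g ` ((`) l ` E)"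
      unfolding xy(3,4) alternate_map[OF inj w xy(1,2)] edge[OF xy(1,2)] .
  qed
  moreover have "avoids (map g w) p"
    unfolding avoids_def
  proof
    assume "\<exists>u. subseq u (map g w) \<and> order_isomorphic u p"
    then obtain u where u: "subseq u (map g w)" "order_isomorphic u p" by blast
    from u(1) obtain N where "u = nths (map g w) N" by (auto simp: subseq_conv_nths)
    then have uv: "u = map g (nths w N)" by (simp add: nths_map)
    have "nths w N ! i \<in> ?A" if "i < length (nths w N)" for i
      using w nth_mem[OF that] set_nths_subset[of w N] by blast
    then have "map g (nths w N) ! i < map g (nths w N) ! j \<longleftrightarrow> nths w N ! i < nths w N ! j"
      if "i < length (nths w N)" "j < length (nths w N)" for i j
      using that by (simp only: nth_map iff)
    then have "order_isomorphic (nths w N) p"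
      using u(2) unfolding uv order_isomorphic_def length_map by metis
    moreover have "subseq (nths w N) w" by (auto simp: subseq_conv_nths)
    ultimately show False using av by (auto simp: avoids_def)
  qed
  moreover have "inj_on (g \<circ> l) V" using l inj by (rule comp_inj_on)
  ultimately have "represented_under p (g \<circ> l) V E"
    unfolding represented_under_def im by blast
  then show ?thesis unfolding pattern_representable_def by blast
qed

end

theory Submission imports Defs
begin

text \<open>The graph is the disjoint union of two copies of \<open>K\<^sub>4\<close>. If the letters of a clique all occur at
  least twice in a representing word, then all their first occurrences precede all their second
  ones, in the same order. For \<open>a < b < c\<close>, avoiding 132 then forces the first occurrences to appear
  in the order \<open>b\<close>, \<open>c\<close>, \<open>a\<close>, and four letters cannot all satisfy this. So each copy of \<open>K\<^sub>4\<close> has a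
  letter occurring at most once; these two letters alternate although they are not adjacent.\<close>

lemma alternate_sym: "alternate x y w \<longleftrightarrow> alternate y x w"
  unfolding alternate_def by (simp add: insert_commute conj_commute)

text \<open>\<open>alternate\<close> speaks of the word restricted to \<open>x\<close> and
  \<open>y\<close>; this carries its content back to positions of \<open>w\<close> itself, where it
  can be compared with a third letter.\<close>

lemma alternate_between:
  assumes alt: "alternate x y w" and "x \<noteq> y" and ij: "i < j" "j < length w" "w ! i = x" "w ! j = x"
  shows "\<exists>k. i < k \<and> k < j \<and> w ! k = y"
proof -
  define P where "P = (\<lambda>z. z \<in> {x, y})"
  define m where "m = drop (Suc i) (take j w)"
  have "take j w = take i w @ x # m"
    unfolding m_def using ij id_take_nth_drop[of i "take j w"] by (simp add: min_def)
  moreover have "w = take j w @ x # drop (Suc j) w"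
    using ij id_take_nth_drop[of j w] by simp
  ultimately have w: "w = take i w @ x # m @ x # drop (Suc j) w"
    by (metis append.assoc append_Cons)
  define p q where "p = filter P (take i w)" and "q = filter P m"
  have f: "filter P w = p @ x # q @ x # filter P (drop (Suc j) w)"
    by (subst w) (simp add: p_def q_def P_def)
  have "separates y x (filter P w)"
    using alt by (simp add: alternate_def P_def)
  \<comment> \<open>These are the places that positions \<open>i\<close> and \<open>j\<close> take
    in the filtered word; only \<open>q\<close>, which comes from the stretch \<open>m\<close> of
    \<open>w\<close> between them, lies in between.\<close>
  from this[unfolded separates_def f, rule_format, of "length p" "Suc (length p + length q)"]
  obtain k where k: "length p < k" "k < Suc (length p + length q)"
      "(p @ x # q @ x # filter P (drop (Suc j) w)) ! k = y"
    by (auto simp: nth_append)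
  then have "q ! (k - Suc (length p)) = y" "k - Suc (length p) < length q"
    by (auto simp: nth_append nth_Cons' split: if_splits)
  then have "y \<in> set m"
    unfolding q_def by (metis filter_is_subset nth_mem subsetD)
  then obtain n where "n < length m" "m ! n = y" by (auto simp: in_set_conv_nth)
  then show ?thesis
    using ij by (intro exI[of _ "Suc i + n"]) (auto simp: m_def)
qed

text \<open>No pair of positions satisfies the premise in \<open>separates\<close>, so the condition
  is vacuous whatever \<open>y\<close> is.\<close>

lemma separates_if_count_le_1:
  assumes "count_list u x \<le> 1"
  shows "separates y x u"
  unfolding separates_def
proof (intro allI impI)
  fix i j assume ij: "i < j \<and> j < length u \<and> u ! i = x \<and> u ! j = x"
  then have "{i, j} \<subseteq> {n. n < length u \<and> u ! n = x}" by auto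
  then have "card {i, j} \<le> card {n. n < length u \<and> u ! n = x}"
    by (rule card_mono[rotated]) simp
  also have "\<dots> \<le> 1"
    using assms unfolding count_list_eq_length_filter length_filter_conv_card
    by (simp add: eq_commute)
  finally show "\<exists>k. i < k \<and> k < j \<and> u ! k = y" using ij by simp
qed

text \<open>Source of the final contradiction: such letters alternate whether or not they are
  adjacent.\<close>

lemma alternate_if_count_le_1:
  assumes "count_list w x \<le> 1" "count_list w y \<le> 1"
  shows "alternate x y w"
proof -
  have "count_list (filter (\<lambda>z. z \<in> {x, y}) w) v \<le> count_list w v" for v
    by (induction w) auto
  then show ?thesis
    using assms le_trans unfolding alternate_def by (blast intro: separates_if_count_le_1)
qed

lemma avoids_132D:
  fixes w :: "'a::linorder list"
  assumes av: "avoids w [1, 3, 2]" and "i < j" "j < k" "k < length w"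
  shows "\<not> (w ! i < w ! k \<and> w ! k < w ! j)"
proof
  assume less: "w ! i < w ! k \<and> w ! k < w ! j"
  have "subseq (map ((!) w) [i, j, k]) (map ((!) w) [0..<length w])"
  proof (rule subseq_map)
    \<comment> \<open>Cutting the index range at \<open>j\<close> and \<open>k\<close> puts each of
      the three indices into a block of its own.\<close>
    have "subseq ([i] @ [j] @ [k]) ([0..<j] @ [j..<k] @ [k..<length w])"
      using assms by (intro list_emb_append_mono) (simp_all add: subseq_singleton_left)
    moreover have "[0..<j] @ [j..<k] @ [k..<length w] = [0..<length w]"
      using assms upt_add_eq_append[of 0 j "length w - j"] upt_add_eq_append[of j k "length w - k"] by simp
    ultimately show "subseq [i, j, k] [0..<length w]" by simp
  qed
  then have "subseq [w ! i, w ! j, w ! k] w" by (simp add: map_nth)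
  moreover have "order_isomorphic [w ! i, w ! j, w ! k] [1, 3, 2]"
    using less by (auto simp: order_isomorphic_def less_Suc_eq numeral_3_eq_3)
  ultimately show False using av by (auto simp: avoids_def)
qed

definition first_two :: "'a list \<Rightarrow> 'a \<Rightarrow> nat \<Rightarrow> nat \<Rightarrow> bool" where
  "first_two w x i j \<longleftrightarrow> i < j \<and> j < length w \<and> w ! i = x \<and> w ! j = x \<and>
     (\<forall>k<j. w ! k = x \<longrightarrow> k = i)"

lemma first_two_exists:
  assumes "2 \<le> count_list w x"
  shows "\<exists>i j. first_two w x i j"
proof -
  obtain u v where u: "w = u @ x # v" "x \<notin> set u"
    using assms count_notin[of x w] split_list_first[of x w] by force
  then have "count_list v x \<noteq> 0" using assms by auto
  then obtain s t where s: "v = s @ x # t" "x \<notin> set s"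
    by (metis count_notin split_list_first)
  have "first_two w x (length u) (length u + Suc (length s))"
    unfolding first_two_def u s
    using u(2) s(2) by (auto simp: nth_append nth_Cons' in_set_conv_nth split: if_splits)
  then show ?thesis by blast
qed

text \<open>Some \<open>y\<close> lies between the first two \<open>x\<close>, so the first
  \<open>y\<close> precedes the second \<open>x\<close>. If \<open>i < k\<close>, the
  \<open>x\<close> between \<open>k\<close> and \<open>l\<close> is not the first one, hence
  \<open>j < l\<close>. If \<open>j < l\<close>, the \<open>y\<close> between \<open>i\<close> and
  \<open>j\<close> comes before the second \<open>y\<close>, so it is the first one and
  \<open>i < k\<close>.\<close>

lemma first_two_interleave:
  assumes alt: "alternate x y w" and "x \<noteq> y"
    and x: "first_two w x i j" and y: "first_two w y k l"
  shows "k < j" "i < k \<longleftrightarrow> j < l"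
proof -
  obtain m where m: "i < m" "m < j" "w ! m = y"
    using alternate_between[OF alt \<open>x \<noteq> y\<close>, of i j] x by (auto simp: first_two_def)
  obtain n where n: "k < n" "n < l" "w ! n = x"
    using alternate_between[of y x w k l] alt alternate_sym \<open>x \<noteq> y\<close> y
    by (metis first_two_def)
  have km: "k \<le> m"
    using y m by (metis first_two_def leI le_less_trans less_imp_le order_less_trans)
  have "i \<le> n"
    using x n by (metis first_two_def leI le_less_trans less_imp_le order_less_trans)
  show "k < j" using km m by simp
  show "i < k \<longleftrightarrow> j < l"
  proof
    assume "i < k"
    then have "n \<noteq> i" using n by simp
    then show "j < l" using x n by (metis first_two_def leI le_less_trans not_less_iff_gr_or_eq)
  next
    assume "j < l"
    then have "m = k" using y m by (metis first_two_def order_less_trans)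
    then show "i < k" using m by simp
  qed
qed

lemma first_two_order_132:
  fixes w :: "'a::linorder list"
  assumes av: "avoids w [1, 3, 2]"
    and less: "a < b" "b < c"
    and alt: "alternate a b w" "alternate a c w" "alternate b c w"
    and a: "first_two w a a1 a2" and b: "first_two w b b1 b2" and c: "first_two w c c1 c2"
  shows "b1 < c1" "c1 < a1"
proof -
  have at: "w ! a1 = a" "w ! b1 = b" "w ! b2 = b" "w ! c1 = c" "w ! c2 = c" "b2 < length w"
    using a b c by (auto simp: first_two_def)
  have ne: "b1 \<noteq> c1" "a1 \<noteq> c1" using at less by auto
  have "a \<noteq> c" "b \<noteq> c" using less by auto
  note bc = first_two_interleave[OF alt(3) \<open>b \<noteq> c\<close> b c]
  note ac = first_two_interleave[OF alt(2) \<open>a \<noteq> c\<close> a c]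
  have cb: "alternate c b w" "c \<noteq> b" using alt(3) less by (auto simp: alternate_sym[of c b])
  have ca: "alternate c a w" "c \<noteq> a" using alt(2) less by (auto simp: alternate_sym[of c a])
  note cb = first_two_interleave[OF cb c b]
  note ca = first_two_interleave[OF ca c a]
  show "b1 < c1"
  proof (rule ccontr)
    assume "\<not> b1 < c1"
    then have "c2 < b2" using ne cb by simp
    \<comment> \<open>The positions \<open>a1 < c2 < b2\<close> carry \<open>a\<close>,
      \<open>c\<close>, \<open>b\<close>, an occurrence of 132.\<close>
    then show False using avoids_132D[OF av ca(1) _ at(6)] at less by simp
  qed
  show "c1 < a1"
  proof (rule ccontr)
    assume "\<not> c1 < a1"
    then have "a1 < c1" using ne by simp
    \<comment> \<open>Here 132 occurs at \<open>a1 < c1 < b2\<close>.\<close>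
    then show False using avoids_132D[OF av _ bc(1) at(6), of a1] at less by simp
  qed
qed

lemma clique_4_count_le_1:
  fixes w :: "'a::linorder list"
  assumes av: "avoids w [1, 3, 2]" and card: "card A = 4"
    and alt: "\<And>x y. x \<in> A \<Longrightarrow> y \<in> A \<Longrightarrow> x \<noteq> y \<Longrightarrow> alternate x y w"
  shows "\<exists>x\<in>A. count_list w x \<le> 1"
proof (rule ccontr)
  assume "\<not> ?thesis"
  then have "\<forall>x\<in>A. \<exists>i j. first_two w x i j"
    by (metis first_two_exists not_less_eq_eq one_add_one plus_1_eq_Suc)
  then obtain f g where fg: "\<And>x. x \<in> A \<Longrightarrow> first_two w x (f x) (g x)" by metis
  have "finite A" using card by (simp add: card_ge_0_finite)
  define s where "s = sorted_list_of_set A"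
  have "length s = 4" "sorted_wrt (<) s" "set s = A"
    using card \<open>finite A\<close> by (auto simp: s_def)
  then obtain a b c d where "a < b" "b < c" "c < d" and A: "a \<in> A" "b \<in> A" "c \<in> A" "d \<in> A"
    by (auto simp: length_Suc_conv numeral_eq_Suc)
  have order: "f y < f z \<and> f z < f x" if "x \<in> A" "y \<in> A" "z \<in> A" "x < y" "y < z" for x y z
    using first_two_order_132[OF av that(4,5) alt alt alt fg fg fg] that by auto
  \<comment> \<open>In the triple \<open>a\<close>, \<open>b\<close>, \<open>c\<close> the letter
    \<open>b\<close> is the smaller of the pair \<open>b\<close>, \<open>c\<close>; in
    \<open>b\<close>, \<open>c\<close>, \<open>d\<close> it is the smallest of all. The two roles
    demand opposite orders of \<open>f b\<close> and \<open>f c\<close>.\<close>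
  have "f b < f c" using order \<open>a < b\<close> \<open>b < c\<close> A by blast
  moreover have "f c < f d \<and> f d < f b" using order \<open>b < c\<close> \<open>c < d\<close> A by blast
  ultimately show False by simp
qed

definition two_K4_edges :: "nat set set" where
  "two_K4_edges = {{x, y} | x y. x < 8 \<and> y < 8 \<and> x \<noteq> y \<and> (x < 4 \<longleftrightarrow> y < 4)}"

lemma two_K4_edge_iff:
  assumes "x < 8" "y < 8" "x \<noteq> y"
  shows "{x, y} \<in> two_K4_edges \<longleftrightarrow> (x < 4 \<longleftrightarrow> y < 4)"
  using assms unfolding two_K4_edges_def by (auto simp: doubleton_eq_iff)

text \<open>\<^const>\<open>circle_graph\<close> does not require the chords to be distinct, so one chord per clique
  suffices.\<close>

lemma two_K4_circle_graph: "circle_graph {..<8} two_K4_edges"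
proof -
  define f where "f x = (if x < 4 then closed_segment 1 \<i> else closed_segment (- 1) (- \<i>))"
    for x :: nat
  \<comment> \<open>The two chords lie on distinct parallel lines, which makes them
    disjoint.\<close>
  have one: "Re z + Im z = 1" if "z \<in> closed_segment 1 \<i>" for z
    using that by (auto simp: in_segment)
  have minus_one: "Re z + Im z = - 1" if "z \<in> closed_segment (- 1) (- \<i>)" for z
    using that by (auto simp: in_segment)
  have disj: "closed_segment 1 \<i> \<inter> closed_segment (- 1) (- \<i>) = {}"
    using one minus_one by fastforce
  have "is_chord 0 1 (f x)" for x
    unfolding is_chord_def f_def
    by (cases "x < 4"; rule exI[of _ "if x < 4 then 1 else - 1"];
        rule exI[of _ "if x < 4 then \<i> else - \<i>"]) (auto simp: complex_eq_iff)
  moreover have "f x \<inter> f y \<noteq> {} \<longleftrightarrow> (x < 4 \<longleftrightarrow> y < 4)" for x y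
    using disj by (auto simp: f_def)
  moreover have "simple_graph {..<8} two_K4_edges"
    by (auto simp: simple_graph_def two_K4_edges_def)
  ultimately show ?thesis
    unfolding circle_graph_def
    by (intro conjI exI[of _ 0] exI[of _ 1] exI[of _ f]) (auto simp: two_K4_edge_iff)
qed

lemma two_K4_not_132_representable: "\<not> pattern_representable [1, 3, 2] {..<8} two_K4_edges"
proof
  assume "pattern_representable [1, 3, 2] {..<8} two_K4_edges"
  then obtain l :: "nat \<Rightarrow> nat" and w where inj: "inj_on l {..<8}"
      and rep: "represents (l ` {..<8}) ((`) l ` two_K4_edges) w" and av: "avoids w [1, 3, 2]"
    unfolding pattern_representable_def represented_under_def by blast
  \<comment> \<open>Injectivity of \<open>l\<close> passes to its action on subsets, so relabelling
    turns no non-edge into an edge.\<close>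
  have edge: "l ` {x, y} \<in> (`) l ` two_K4_edges \<longleftrightarrow> {x, y} \<in> two_K4_edges"
    if "x < 8" "y < 8" for x y
  proof (rule inj_on_image_mem_iff[of _ "Pow {..<8}"])
    show "inj_on ((`) l) (Pow {..<8})" using inj by (rule inj_on_image_Pow)
  qed (use that in \<open>auto simp: two_K4_edges_def\<close>)
  have alt: "alternate (l x) (l y) w \<longleftrightarrow> (x < 4 \<longleftrightarrow> y < 4)" if "x < 8" "y < 8" "x \<noteq> y" for x y
  proof -
    have "l x \<noteq> l y" using inj that by (auto dest: inj_onD)
    then have "alternate (l x) (l y) w \<longleftrightarrow> l ` {x, y} \<in> (`) l ` two_K4_edges"
      using rep that by (auto simp: represents_def)
    then show ?thesis using edge two_K4_edge_iff that by simp
  qed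
  have single: "\<exists>x\<in>A. count_list w (l x) \<le> 1"
    if A: "A \<subseteq> {..<8}" "card A = 4" "\<And>x y. x \<in> A \<Longrightarrow> y \<in> A \<Longrightarrow> x < 4 \<longleftrightarrow> y < 4" for A
  proof -
    have "card (l ` A) = 4" using A inj by (metis card_image inj_on_subset)
    moreover have "alternate x y w" if xy: "x \<in> l ` A" "y \<in> l ` A" "x \<noteq> y" for x y
    proof -
      obtain u v where "u \<in> A" "v \<in> A" "x = l u" "y = l v" using xy by blast
      then show ?thesis using A(1) A(3)[of u v] alt[of u v] \<open>x \<noteq> y\<close> by auto
    qed
    ultimately show ?thesis using clique_4_count_le_1[OF av, of "l ` A"] by blast
  qed
  obtain x where x: "x < 4" "count_list w (l x) \<le> 1"
    using single[of "{..<4}"] by auto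
  obtain y where y: "4 \<le> y" "y < 8" "count_list w (l y) \<le> 1"
    using single[of "{4..<8}"] by (auto simp: subset_iff)
  \<comment> \<open>The vertices \<open>x\<close> and \<open>y\<close> come from different cliques,
    so their labels should not alternate.\<close>
  have "alternate (l x) (l y) w" using x y by (intro alternate_if_count_le_1)
  then show False using alt[of x y] x y by simp
qed

theorem theorem5p1:
  "\<exists>(V :: nat set) E. circle_graph V E \<and> \<not> pattern_representable [1, 3, 2] V E"
  using two_K4_circle_graph two_K4_not_132_representable by blast

end
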